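(* Let $n \geq 1$ be an integer, let $D = \sum_{i=1}^n a_i v_i$ be a super sorted, concentrated divisor on the complete graph $K_n$, and let $e_i = a_i - i + 1$ for $1 \leq i \leq n$. Then $D$ has splitting type $(e_1, \ldots, e_n)$.
   Context: $K_n$ is the complete graph with $n$ vertices $v_1, \ldots, v_n$, in which every pair of distinct vertices is joined by exactly one edge. A divisor on $K_n$ is a formal $\mathbb{Z}$-linear combination $D = \sum_{i=1}^n a_i v_i$ of the vertices (with $a_i \in \mathbb{Z}$, possibly negative); its degree is $\deg(D) = \sum_{i=1}^n a_i$, and it is effective if $a_i \geq 0$ for all $i$. Firing a vertex $v_j$ replaces $D$ by the divisor obtained by decreasing the coefficient of $v_j$ by $n-1$ and increasing the coefficient of every other vertex by $1$. Two divisors are equivalent if one can be obtained from the other by a finite sequence of such chip-firing moves. Rank: if $D$ is not equivalent to an effective divisor, then $\mathrm{rk}(D) = -1$. Otherwise $\mathrm{rk}(D)$ is the maximum integer $r$ such that, for all effective divisors $E$ of degree $r$, the divisor $D - E$ is equivalent to an effective divisor. Let $L = v_1 + v_2 + \cdots + v_n$. For integers $e_1, \ldots, e_n$, a divisor $D$ on $K_n$ has splitting type $(e_1, \ldots, e_n)$ if $$\mathrm{rk}(D + kL) = \Big( \sum_{i=1}^n \max\{0, e_i + k + 1\} \Big) - 1 \quad \text{for all } k \in \mathbb{Z}.$$ A divisor $D = \sum_{i=1}^n a_i v_i$ on $K_n$ is super sorted if $a_1 \leq a_2 \leq \cdots \leq a_n$. It is concentrated if, for every integer $i$ with $1 \leq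 i \leq n$, we have $\# \{ j \in \{1,\ldots,n\} \mid a_j - \min_{1 \leq k \leq n} a_k \leq i-1 \} \geq i$. *)

theory Defs
  imports Main
begin

text \<open>The vertex \<open>v_i\<close> of the complete graph \<open>K_n\<close> is represented by its index \<open>i \<in> {1..n}\<close>, and a
  divisor by its coefficient function. Coefficients outside \<open>{1..n}\<close> are required to be \<open>0\<close>, so that
  equality of divisors is equality of functions.\<close>

definition divisor :: "nat \<Rightarrow> (nat \<Rightarrow> int) \<Rightarrow> bool" where
  "divisor n D \<longleftrightarrow> (\<forall>i. i \<notin> {1..n} \<longrightarrow> D i = 0)"

definition deg :: "nat \<Rightarrow> (nat \<Rightarrow> int) \<Rightarrow> int" where
  "deg n D = (\<Sum>i = 1..n. D i)"

definition effective :: "nat \<Rightarrow> (nat \<Rightarrow> int) \<Rightarrow> bool" where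
  "effective n D \<longleftrightarrow> divisor n D \<and> (\<forall>i\<in>{1..n}. 0 \<le> D i)"

definition fire :: "nat \<Rightarrow> nat \<Rightarrow> (nat \<Rightarrow> int) \<Rightarrow> (nat \<Rightarrow> int)" where
  "fire n j D = (\<lambda>i. if i = j then D i - (int n - 1)
                     else if i \<in> {1..n} then D i + 1 else D i)"

definition fires_to :: "nat \<Rightarrow> (nat \<Rightarrow> int) \<Rightarrow> (nat \<Rightarrow> int) \<Rightarrow> bool" where
  "fires_to n D D' \<longleftrightarrow> (\<exists>j\<in>{1..n}. D' = fire n j D)"

definition equivalent :: "nat \<Rightarrow> (nat \<Rightarrow> int) \<Rightarrow> (nat \<Rightarrow> int) \<Rightarrow> bool" where
  "equivalent n D D' \<longleftrightarrow> (fires_to n)\<^sup>*\<^sup>* D D' \<or> (fires_to n)\<^sup>*\<^sup>* D' D"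

definition equiv_effective :: "nat \<Rightarrow> (nat \<Rightarrow> int) \<Rightarrow> bool" where
  "equiv_effective n D \<longleftrightarrow> (\<exists>D'. effective n D' \<and> equivalent n D D')"

text \<open>For \<open>n \<ge> 1\<close> the maximum in the second branch exists: \<open>r = 0\<close> has the required property, and no
  \<open>r > deg n D\<close> has it, because firing preserves the degree.\<close>

definition rk :: "nat \<Rightarrow> (nat \<Rightarrow> int) \<Rightarrow> int" where
  "rk n D =
    (if \<not> equiv_effective n D then - 1
     else (GREATEST r. \<forall>E. effective n E \<and> deg n E = r \<longrightarrow> equiv_effective n (\<lambda>i. D i - E i)))"

definition L :: "nat \<Rightarrow> nat \<Rightarrow> int" where
  "L n = (\<lambda>i. if i \<in> {1..n} then 1 else 0)"

definition has_splitting_type :: "nat \<Rightarrow> (nat \<Rightarrow> int) \<Rightarrow> (nat \<Rightarrow> int) \<Rightarrow> bool" where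
  "has_splitting_type n D e \<longleftrightarrow>
    (\<forall>k::int. rk n (\<lambda>i. D i + k * L n i) = (\<Sum>i = 1..n. max 0 (e i + k + 1)) - 1)"

definition super_sorted :: "nat \<Rightarrow> (nat \<Rightarrow> int) \<Rightarrow> bool" where
  "super_sorted n D \<longleftrightarrow> mono_on {1..n} D"

definition concentrated :: "nat \<Rightarrow> (nat \<Rightarrow> int) \<Rightarrow> bool" where
  "concentrated n D \<longleftrightarrow>
    (\<forall>i\<in>{1..n}. card {j \<in> {1..n}. D j - Min (D ` {1..n}) \<le> int i - 1} \<ge> i)"

end

theory Submission
  imports Defs
begin

text \<open>
  Write \<open>S\<^sub>D(y) = \<Sum>\<^sub>i \<lfloor>(D\<^sub>i - y) / n\<rfloor>\<close>. On \<open>K\<^sub>n\<close> equivalence of divisors means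
  \<open>D'\<^sub>i = D\<^sub>i + \<Sum> f - n f\<^sub>i\<close> for some integer vector \<open>f\<close>, and choosing every \<open>f\<^sub>i\<close> as large as
  effectivity allows shows that \<open>D\<close> is equivalent to an effective divisor if and only if
  \<open>S\<^sub>D(y) \<ge> -y\<close> for some integer \<open>y\<close> (lemma \<open>equiv_effective_iff\<close>).

  Hermite's identity \<open>\<Sum>\<^sub>y\<^sub><\<^sub>n \<lfloor>(m - y) / n\<rfloor> = m - n + 1\<close> measures degrees by the same sums: if \<open>F\<close> is
  obtained from \<open>D\<close> by removing an effective divisor \<open>E\<close>, then
  \<open>deg E = \<Sum>\<^sub>y\<^sub><\<^sub>n (S\<^sub>D(y) - S\<^sub>F(y))\<close>. Every summand is nonnegative, and if \<open>F\<close> is not equivalent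
  to an effective divisor, then \<open>S\<^sub>F(y) \<le> -y - 1\<close>. So the cost of such an \<open>E\<close> is at least
  \<open>\<Sum>\<^sub>y\<^sub><\<^sub>n max 0 (S\<^sub>D(y) + y + 1)\<close>.

  For a super sorted and concentrated \<open>D\<close> this bound is attained by the \<open>E\<close> that cuts \<open>D\<close> down to
  \<open>F\<^sub>i = min D\<^sub>i (i - 2)\<close>. Such an \<open>F\<close> lies below the divisor with coefficients
  \<open>-1, 0, \<dots>, n - 2\<close>, for which the sum is exactly \<open>-y - 1\<close>, so \<open>F\<close> is not equivalent to an
  effective divisor. It costs no more than the bound because, for each fixed \<open>y\<close>, the floors of
  \<open>F\<close> agree in all coordinates at once either with those of \<open>D\<close> or with those of
  \<open>-1, 0, \<dots>, n - 2\<close> (lemma \<open>truncation_dichotomy\<close>). Hence the rank of \<open>D\<close> is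
  \<open>deg E - 1 = \<Sum>\<^sub>i max 0 (D\<^sub>i - i + 2) - 1\<close>. Adding a multiple of \<open>L\<close> preserves both hypotheses,
  so this formula for the rank at all twists is the splitting type.
\<close>

section \<open>Hermite's identity\<close>

text \<open>Replacing \<open>x\<close> by \<open>x + 1\<close> shifts the window of \<open>n\<close> consecutive integers by one step, which trades
  the quotient of \<open>x\<close> for that of \<open>x + n\<close>; so both sides grow by one.\<close>

lemma sum_floor_shift:
  fixes x :: int
  assumes "n \<ge> 1"
  shows "(\<Sum>i<n. (x + int i) div int n) = x"
proof -
  have increment: "(\<Sum>i<n. (z + 1 + int i) div int n) = (\<Sum>i<n. (z + int i) div int n) + 1" for z :: int
  proof -
    have "(\<Sum>i<n. (z + 1 + int i) div int n - (z + int i) div int n)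
        = (\<Sum>i<n. (z + int (Suc i)) div int n - (z + int i) div int n)"
      by (intro sum.cong) (auto simp: algebra_simps)
    also have "\<dots> = (z + int n) div int n - (z + int 0) div int n"
      by (rule sum_lessThan_telescope)
    also have "\<dots> = 1" using assms div_add_self2[of "int n" z] by simp
    finally show ?thesis by (simp add: sum_subtractf)
  qed
  show ?thesis
  proof (induction x rule: int_induct[where k = 0])
    case base
    have "(\<Sum>i<n. (0 + int i) div int n) = (\<Sum>i<n. 0)"
      by (intro sum.cong) auto
    then show ?case by simp
  next
    case (step1 x)
    then show ?case using increment[of x] by simp
  next
    case (step2 x)
    then show ?case using increment[of "x - 1"] by simp
  qed
qed

lemma sum_floor_shift_down:
  fixes m :: int
  assumes "n \<ge> 1"
  shows "(\<Sum>y<n. (m - int y) div int n) = m - int n + 1"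
proof -
  have "(\<Sum>y<n. (m - int y) div int n) = (\<Sum>y<n. (m - int (n - Suc y)) div int n)"
    by (rule sum.nat_diff_reindex[symmetric])
  also have "\<dots> = (\<Sum>y<n. ((m - int n + 1) + int y) div int n)"
    by (intro sum.cong) (auto simp: of_nat_diff algebra_simps)
  finally show ?thesis using sum_floor_shift[OF assms] by simp
qed

section \<open>Divisors equivalent to effective ones\<close>

definition fire_all :: "nat \<Rightarrow> (nat \<Rightarrow> int) \<Rightarrow> (nat \<Rightarrow> int) \<Rightarrow> (nat \<Rightarrow> int)" where
  "fire_all n f D = (\<lambda>i. if i \<in> {1..n} then D i + sum f {1..n} - int n * f i else D i)"

lemma fire_fire_all:
  assumes "j \<in> {1..n}"
  shows "fire n j (fire_all n f D) = fire_all n (f(j := f j + 1)) D"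
proof -
  have "sum (f(j := f j + 1)) {1..n} = sum f {1..n} + 1"
    using assms by (simp add: sum.remove[of _ j] sum.If_cases)
  then show ?thesis
    using assms by (auto simp: fire_def fire_all_def algebra_simps fun_eq_iff)
qed

lemma fires_to_imp_fire_all:
  assumes "(fires_to n)\<^sup>*\<^sup>* D D'"
  shows "\<exists>f. D' = fire_all n f D"
  using assms
proof (induction rule: rtranclp_induct)
  case base
  have "D = fire_all n (\<lambda>_. 0) D" by (auto simp: fire_all_def)
  then show ?case by blast
next
  case (step D' D'')
  then show ?case by (auto simp: fires_to_def fire_fire_all)
qed

lemma fires_to_fire_all_nonneg:
  assumes "\<And>i. i \<in> {1..n} \<Longrightarrow> 0 \<le> f i"
  shows "(fires_to n)\<^sup>*\<^sup>* D (fire_all n f D)"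
  using assms
proof (induction "nat (sum f {1..n})" arbitrary: f)
  case 0
  then have "\<forall>i\<in>{1..n}. f i = 0"
    using sum_nonneg_eq_0_iff[of "{1..n}" f] sum_nonneg[of "{1..n}" f] by auto
  then have "fire_all n f D = D" by (auto simp: fire_all_def)
  then show ?case by simp
next
  case (Suc m)
  have "\<exists>j\<in>{1..n}. f j > 0"
  proof (rule ccontr)
    assume "\<not> ?thesis"
    then have "sum f {1..n} \<le> 0" by (intro sum_nonpos) (auto simp: not_less)
    then show False using Suc.hyps(2) by simp
  qed
  then obtain j where j: "j \<in> {1..n}" "f j > 0" by blast
  define g where "g = f(j := f j - 1)"
  have f: "f = g(j := g j + 1)" by (auto simp: g_def)
  have "sum f {1..n} = sum g {1..n} + 1"
    unfolding g_def using j by (simp add: sum.remove[of _ j] sum.If_cases)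
  then have "m = nat (sum g {1..n})" using Suc.hyps(2) by simp
  moreover have "\<And>i. i \<in> {1..n} \<Longrightarrow> 0 \<le> g i" using j Suc.prems by (auto simp: g_def)
  ultimately have "(fires_to n)\<^sup>*\<^sup>* D (fire_all n g D)" by (rule Suc.hyps(1))
  moreover have "fires_to n (fire_all n g D) (fire_all n f D)"
    unfolding fires_to_def using fire_fire_all[OF j(1), of g D] f j(1) by metis
  ultimately show ?case by simp
qed

text \<open>Firing every vertex equally often changes nothing, so a firing vector with negative entries can
  be replaced by one with nonnegative entries.\<close>

lemma fires_to_fire_all:
  "(fires_to n)\<^sup>*\<^sup>* D (fire_all n f D)"
proof -
  define t where "t = (\<Sum>i=1..n. \<bar>f i\<bar>)"
  have "fire_all n (\<lambda>i. f i + t) D = fire_all n f D"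
    by (auto simp: fire_all_def sum.distrib algebra_simps)
  moreover have "0 \<le> f i + t" if "i \<in> {1..n}" for i
    using member_le_sum[of i "{1..n}" "\<lambda>i. \<bar>f i\<bar>"] that by (simp add: t_def)
  ultimately show ?thesis using fires_to_fire_all_nonneg[of n "\<lambda>i. f i + t" D] by simp
qed

lemma equivalent_imp_fire_all:
  assumes "equivalent n D D'"
  shows "\<exists>f. D' = fire_all n f D"
proof -
  from assms consider "(fires_to n)\<^sup>*\<^sup>* D D'" | "(fires_to n)\<^sup>*\<^sup>* D' D"
    by (auto simp: equivalent_def)
  then show ?thesis
  proof cases
    case 1
    then show ?thesis by (rule fires_to_imp_fire_all)
  next
    case 2
    then obtain f where "D = fire_all n f D'" using fires_to_imp_fire_all by blast
    then have "D' = fire_all n (\<lambda>i. - f i) D"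
      by (auto simp: fire_all_def sum_negf fun_eq_iff)
    then show ?thesis by blast
  qed
qed

text \<open>Once the total number \<open>c\<close> of firings is prescribed, a coordinate stays nonnegative exactly when
  its own vertex fires at most \<open>(D i + c) div n\<close> times; effectivity is possible exactly when these
  caps leave room for \<open>c\<close> firings.\<close>

lemma equiv_effective_iff:
  assumes "n \<ge> 1" "divisor n D"
  shows "equiv_effective n D \<longleftrightarrow> (\<exists>c. c \<le> (\<Sum>i=1..n. (D i + c) div int n))"
proof
  assume "equiv_effective n D"
  then obtain D' where "effective n D'" and "equivalent n D D'"
    by (auto simp: equiv_effective_def)
  then obtain f where f: "D' = fire_all n f D" using equivalent_imp_fire_all by blast
  have "f i \<le> (D i + sum f {1..n}) div int n" if "i \<in> {1..n}" for i
  proof -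
    have "f i * int n \<le> D i + sum f {1..n}"
      using \<open>effective n D'\<close> that by (auto simp: f effective_def fire_all_def algebra_simps)
    then have "(f i * int n) div int n \<le> (D i + sum f {1..n}) div int n"
      using assms(1) by (intro zdiv_mono1) auto
    then show ?thesis using assms(1) by simp
  qed
  then have "sum f {1..n} \<le> (\<Sum>i=1..n. (D i + sum f {1..n}) div int n)" by (rule sum_mono)
  then show "\<exists>c. c \<le> (\<Sum>i=1..n. (D i + c) div int n)" by blast
next
  assume "\<exists>c. c \<le> (\<Sum>i=1..n. (D i + c) div int n)"
  then obtain c where c: "c \<le> (\<Sum>i=1..n. (D i + c) div int n)" by blast
  define g where "g = (\<lambda>i. (D i + c) div int n)"
  \<comment> \<open>The unused firings are all taken away from the first vertex.\<close>
  define f where "f = g(1 := g 1 - (sum g {1..n} - c))"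
  have sum_f: "sum f {1..n} = c"
    using assms(1) by (simp add: f_def sum.remove[of _ 1] sum.If_cases)
  have "0 \<le> D i + c - int n * f i" if "i \<in> {1..n}" for i
  proof -
    have "f i \<le> g i" using c by (auto simp: f_def g_def)
    then have "int n * f i \<le> int n * g i" by (simp add: mult_left_mono)
    also have "\<dots> \<le> D i + c"
      using assms(1) pos_mod_sign[of "int n" "D i + c"] by (simp add: g_def minus_mod_eq_mult_div[symmetric])
    finally show ?thesis by simp
  qed
  then have "effective n (fire_all n f D)"
    using assms(2) unfolding effective_def divisor_def fire_all_def sum_f by auto
  moreover have "equivalent n D (fire_all n f D)"
    by (simp add: equivalent_def fires_to_fire_all)
  ultimately show "equiv_effective n D" by (auto simp: equiv_effective_def)
qed

section \<open>Removing chips until no equivalent divisor is effective\<close>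

lemma sum_diff_by_floors:
  fixes D F :: "nat \<Rightarrow> int"
  assumes "n \<ge> 1"
  shows "(\<Sum>i=1..n. D i - F i)
    = (\<Sum>y<n. (\<Sum>i=1..n. (D i - int y) div int n) - (\<Sum>i=1..n. (F i - int y) div int n))"
proof -
  have "(\<Sum>i=1..n. D i - F i)
      = (\<Sum>i=1..n. (\<Sum>y<n. (D i - int y) div int n) - (\<Sum>y<n. (F i - int y) div int n))"
    by (simp add: sum_floor_shift_down[OF assms])
  also have "\<dots> = (\<Sum>i=1..n. \<Sum>y<n. (D i - int y) div int n - (F i - int y) div int n)"
    by (simp add: sum_subtractf)
  also have "\<dots> = (\<Sum>y<n. \<Sum>i=1..n. (D i - int y) div int n - (F i - int y) div int n)"
    by (rule sum.swap)
  finally show ?thesis by (simp add: sum_subtractf)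
qed

text \<open>The bound holds separately at every \<open>y\<close>: passing from \<open>D\<close> to \<open>F = D - E\<close> lowers the floor sum by
  at least \<open>0\<close>, because \<open>E \<ge> 0\<close>, and brings it to at most \<open>-y - 1\<close>, because \<open>F\<close> is not equivalent
  to an effective divisor.\<close>

lemma deg_ge_of_not_equiv_effective:
  assumes "n \<ge> 1" "divisor n D" "effective n E"
    and "\<not> equiv_effective n (\<lambda>i. D i - E i)"
  shows "(\<Sum>y<n. max 0 ((\<Sum>i=1..n. (D i - int y) div int n) + int y + 1)) \<le> deg n E"
proof -
  define F where "F = (\<lambda>i. D i - E i)"
  have "divisor n F" using assms(2,3) by (auto simp: F_def effective_def divisor_def)
  then have stuck: "(\<Sum>i=1..n. (F i + c) div int n) < c" for c
    using equiv_effective_iff[OF assms(1)] assms(4) by (auto simp: F_def not_le)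
  have "deg n E = (\<Sum>i=1..n. D i - F i)" by (simp add: deg_def F_def)
  also have "\<dots> = (\<Sum>y<n. (\<Sum>i=1..n. (D i - int y) div int n) - (\<Sum>i=1..n. (F i - int y) div int n))"
    by (rule sum_diff_by_floors[OF assms(1)])
  also have "\<dots> \<ge> (\<Sum>y<n. max 0 ((\<Sum>i=1..n. (D i - int y) div int n) + int y + 1))"
  proof (rule sum_mono)
    fix y
    have "(\<Sum>i=1..n. (F i - int y) div int n) \<le> (\<Sum>i=1..n. (D i - int y) div int n)"
      using assms(1,3) by (intro sum_mono zdiv_mono1) (auto simp: F_def effective_def)
    moreover have "(\<Sum>i=1..n. (F i - int y) div int n) < - int y"
      using stuck[of "- int y"] by simp
    ultimately show "max 0 ((\<Sum>i=1..n. (D i - int y) div int n) + int y + 1)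
        \<le> (\<Sum>i=1..n. (D i - int y) div int n) - (\<Sum>i=1..n. (F i - int y) div int n)"
      by simp
  qed
  finally show ?thesis .
qed

lemma sum_floor_staircase:
  assumes "n \<ge> 1"
  shows "(\<Sum>i=1..n. (int i - 2 + c) div int n) = c - 1"
proof -
  have "(\<Sum>i=1..n. (int i - 2 + c) div int n) = (\<Sum>i<n. (int (Suc i) - 2 + c) div int n)"
    by (simp add: sum.atLeast1_atMost_eq)
  also have "\<dots> = (\<Sum>i<n. ((c - 1) + int i) div int n)"
    by (intro sum.cong) (auto simp: algebra_simps)
  finally show ?thesis using sum_floor_shift[OF assms] by simp
qed

lemma not_equiv_effective_below_staircase:
  assumes "n \<ge> 1" "divisor n F" "\<And>i. i \<in> {1..n} \<Longrightarrow> F i \<le> int i - 2"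
  shows "\<not> equiv_effective n F"
proof -
  have "(\<Sum>i=1..n. (F i + c) div int n) < c" for c
  proof -
    have "(\<Sum>i=1..n. (F i + c) div int n) \<le> (\<Sum>i=1..n. (int i - 2 + c) div int n)"
      using assms(1,3) by (intro sum_mono zdiv_mono1) auto
    then show ?thesis using sum_floor_staircase[OF assms(1), of c] by simp
  qed
  then show ?thesis using equiv_effective_iff[OF assms(1,2)] by (simp add: not_le)
qed

section \<open>The rank of a concentrated divisor\<close>

lemma concentrated_le:
  assumes "super_sorted n D" "concentrated n D" "i \<in> {1..n}"
  shows "D i \<le> D 1 + int i - 1"
proof (rule ccontr)
  assume "\<not> ?thesis"
  then have large: "D 1 + int i - 1 < D i" by simp
  have mono: "D j \<le> D k" if "j \<in> {1..n}" "k \<in> {1..n}" "j \<le> k" for j k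
    using assms(1) that by (auto simp: super_sorted_def mono_on_def)
  have "Min (D ` {1..n}) = D 1"
    using assms(3) mono by (intro Min_eqI) auto
  then have "{j \<in> {1..n}. D j - Min (D ` {1..n}) \<le> int i - 1} \<subseteq> {1..<i}"
    using large mono[OF assms(3)] by (force simp: not_less)
  then have "card {j \<in> {1..n}. D j - Min (D ` {1..n}) \<le> int i - 1} \<le> card {1..<i}"
    by (intro card_mono) auto
  moreover have "i \<le> card {j \<in> {1..n}. D j - Min (D ` {1..n}) \<le> int i - 1}"
    using assms(2,3) by (simp add: concentrated_def)
  ultimately have "i \<le> i - 1" by simp
  moreover have "1 \<le> i" using assms(3) by simp
  ultimately show False by linarith
qed

text \<open>The staircase value \<open>(i - 2 - y) div n\<close> is \<open>-1\<close> for \<open>i \<le> y + 1\<close> and \<open>0\<close> for the later \<open>i\<close>. Let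
  \<open>D 1 \<ge> 0\<close>. If \<open>D\<close> is at least \<open>y\<close> at all the later \<open>i\<close>, its floors dominate these values. Otherwise
  \<open>D i < y\<close> for some later \<open>i\<close>; by sortedness the floors of \<open>D\<close> are negative up to \<open>y + 1\<close>, and since
  concentration bounds all of \<open>D\<close> by \<open>D 1 + n - 1 < y + n\<close>, they are nowhere positive. If
  \<open>D 1 < 0\<close>, concentration puts \<open>D\<close> itself below the staircase.\<close>

lemma truncation_dichotomy:
  assumes "super_sorted n D" "y < n"
    and conc: "\<And>i. i \<in> {1..n} \<Longrightarrow> D i \<le> D 1 + int i - 1"
  shows "(\<forall>i\<in>{1..n}. (D i - int y) div int n \<le> (int i - 2 - int y) div int n) \<or>
         (\<forall>i\<in>{1..n}. (int i - 2 - int y) div int n \<le> (D i - int y) div int n)"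
proof -
  have mono: "D j \<le> D k" if "j \<in> {1..n}" "k \<in> {1..n}" "j \<le> k" for j k
    using assms(1) that by (auto simp: super_sorted_def mono_on_def)
  have low: "(int i - 2 - int y) div int n = -1" if "i \<in> {1..n}" "i \<le> y + 1" for i
    using that assms(2) by (intro int_div_pos_eq[where r = "int n + int i - 2 - int y"]) auto
  have high: "(int i - 2 - int y) div int n = 0" if "i \<in> {1..n}" "y + 1 < i" for i
    using that assms(2) by (intro div_pos_pos_trivial) auto
  consider "D 1 < 0" | "D 1 \<ge> 0" "\<forall>i\<in>{1..n}. y + 1 < i \<longrightarrow> int y \<le> D i"
    | i where "i \<in> {1..n}" "y + 1 < i" "D i < int y" by force
  then show ?thesis
  proof cases
    case 1
    then have "\<forall>i\<in>{1..n}. D i \<le> int i - 2" using conc by force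
    then show ?thesis using assms(2) by (auto intro: zdiv_mono1)
  next
    case 2
    have "(int i - 2 - int y) div int n \<le> (D i - int y) div int n" if i: "i \<in> {1..n}" for i
    proof (cases "i \<le> y + 1")
      case True
      have "0 \<le> D i" using 2(1) mono[of 1 i] i by auto
      then have "(-1) * int n div int n \<le> (D i - int y) div int n"
        using assms(2) by (intro zdiv_mono1) auto
      also have "(-1) * int n div int n = -1"
        using assms(2) by (intro nonzero_mult_div_cancel_right) simp
      finally show ?thesis using low[OF i True] by simp
    next
      case False
      then show ?thesis using 2(2) high[of i] i assms(2) by (simp add: pos_imp_zdiv_nonneg_iff)
    qed
    then show ?thesis by blast
  next
    case (3 i)
    have "(D j - int y) div int n \<le> (int j - 2 - int y) div int n" if j: "j \<in> {1..n}" for j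
    proof (cases "j \<le> y + 1")
      case True
      then have "D j < int y" using mono[of j i] j 3 by auto
      then have "(D j - int y) div int n < 0"
        using assms(2) by (simp add: pos_imp_zdiv_neg_iff)
      then show ?thesis using low[OF j True] by simp
    next
      case False
      have "D 1 < int y" using mono[of 1 i] 3 by auto
      then have "(D j - int y) div int n \<le> (int n - 1) div int n"
        using conc[OF j] j by (intro zdiv_mono1) auto
      also have "\<dots> = 0" using assms(2) by (intro div_pos_pos_trivial) auto
      finally show ?thesis using high[OF j] False by simp
    qed
    then show ?thesis by blast
  qed
qed

lemma truncation_cost_le:
  assumes "n \<ge> 1" "super_sorted n D" "concentrated n D"
  shows "(\<Sum>i=1..n. max 0 (D i - int i + 2))
    \<le> (\<Sum>y<n. max 0 ((\<Sum>i=1..n. (D i - int y) div int n) + int y + 1))"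
proof -
  define F where "F = (\<lambda>i. min (D i) (int i - 2))"
  have "(\<Sum>i=1..n. max 0 (D i - int i + 2)) = (\<Sum>i=1..n. D i - F i)"
    by (intro sum.cong) (auto simp: F_def)
  also have "\<dots> = (\<Sum>y<n. (\<Sum>i=1..n. (D i - int y) div int n) - (\<Sum>i=1..n. (F i - int y) div int n))"
    by (rule sum_diff_by_floors[OF assms(1)])
  also have "\<dots> \<le> (\<Sum>y<n. max 0 ((\<Sum>i=1..n. (D i - int y) div int n) + int y + 1))"
  proof (rule sum_mono)
    fix y assume "y \<in> {..<n}"
    then have y: "y < n" by simp
    have floor_F: "(F i - int y) div int n
        = min ((D i - int y) div int n) ((int i - 2 - int y) div int n)" for i
    proof -
      have "mono (\<lambda>x. (x - int y) div int n)"
        using y by (intro monoI zdiv_mono1) auto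
      from min_of_mono[OF this, of "D i" "int i - 2"] show ?thesis by (simp add: F_def)
    qed
    have "(\<forall>i\<in>{1..n}. (D i - int y) div int n \<le> (int i - 2 - int y) div int n) \<or>
        (\<forall>i\<in>{1..n}. (int i - 2 - int y) div int n \<le> (D i - int y) div int n)"
      using concentrated_le[OF assms(2,3)] by (rule truncation_dichotomy[OF assms(2) y])
    then have "(\<Sum>i=1..n. (F i - int y) div int n) = (\<Sum>i=1..n. (D i - int y) div int n) \<or>
        (\<Sum>i=1..n. (F i - int y) div int n) = (\<Sum>i=1..n. (int i - 2 - int y) div int n)"
      unfolding floor_F by (elim disj_forward) (auto intro!: sum.cong simp: min_absorb1 min_absorb2)
    then show "(\<Sum>i=1..n. (D i - int y) div int n) - (\<Sum>i=1..n. (F i - int y) div int n)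
        \<le> max 0 ((\<Sum>i=1..n. (D i - int y) div int n) + int y + 1)"
      using sum_floor_staircase[OF assms(1), of "- int y"] by auto
  qed
  finally show ?thesis .
qed

lemma rk_concentrated:
  assumes "n \<ge> 1" "divisor n D" "super_sorted n D" "concentrated n D"
  shows "rk n D = (\<Sum>i=1..n. max 0 (D i - int i + 2)) - 1"
proof -
  define R where "R = (\<Sum>i=1..n. max 0 (D i - int i + 2))"
  have lower: "R \<le> deg n E" if "effective n E" "\<not> equiv_effective n (\<lambda>i. D i - E i)" for E
    using truncation_cost_le[OF assms(1,3,4)] deg_ge_of_not_equiv_effective[OF assms(1,2) that]
    by (simp add: R_def)
  have upper: "\<exists>E. effective n E \<and> deg n E = r \<and> \<not> equiv_effective n (\<lambda>i. D i - E i)"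
    if "R \<le> r" for r
  proof -
    \<comment> \<open>Chips in excess of \<open>R\<close> are also removed from the first vertex, so the difference stays below
      the staircase.\<close>
    define E0 where "E0 = (\<lambda>i. if i \<in> {1..n} then max 0 (D i - int i + 2) else 0)"
    define E where "E = E0(1 := E0 1 + (r - R))"
    have "deg n E0 = R" by (simp add: deg_def E0_def R_def)
    then have "deg n E = r"
      using assms(1) by (simp add: E_def deg_def sum.remove[of _ 1] sum.If_cases)
    moreover have eff: "effective n E"
      using that assms(1) by (auto simp: E_def E0_def effective_def divisor_def)
    moreover have "\<not> equiv_effective n (\<lambda>i. D i - E i)"
      using eff assms(2) that
      by (intro not_equiv_effective_below_staircase[OF assms(1)])
        (auto simp: effective_def divisor_def E_def E0_def)
    ultimately show ?thesis by blast
  qed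
  show ?thesis
  proof (cases "equiv_effective n D")
    case False
    have "effective n (\<lambda>_. 0)" by (simp add: effective_def divisor_def)
    then have "R \<le> 0" using lower[of "\<lambda>_. 0"] False by (simp add: deg_def)
    moreover have "0 \<le> R" unfolding R_def by (intro sum_nonneg) auto
    ultimately show ?thesis using False by (simp add: rk_def R_def)
  next
    case True
    have "(GREATEST r. \<forall>E. effective n E \<and> deg n E = r \<longrightarrow> equiv_effective n (\<lambda>i. D i - E i))
        = R - 1"
    proof (rule Greatest_equality)
      show "\<forall>E. effective n E \<and> deg n E = R - 1 \<longrightarrow> equiv_effective n (\<lambda>i. D i - E i)"
        using lower by force
    next
      fix r
      assume "\<forall>E. effective n E \<and> deg n E = r \<longrightarrow> equiv_effective n (\<lambda>i. D i - E i)"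
      then show "r \<le> R - 1" using upper[of r] by force
    qed
    then show ?thesis using True by (simp add: rk_def R_def)
  qed
qed

lemma super_sorted_twist:
  assumes "super_sorted n D"
  shows "super_sorted n (\<lambda>i. D i + k * L n i)"
  using assms by (auto simp: super_sorted_def mono_on_def L_def)

lemma concentrated_twist:
  assumes "n \<ge> 1" "concentrated n D"
  shows "concentrated n (\<lambda>i. D i + k * L n i)"
proof -
  have "(\<lambda>i. D i + k * L n i) ` {1..n} = (\<lambda>x. x + k) ` (D ` {1..n})"
    by (auto simp: L_def image_image)
  also have "Min \<dots> = Min (D ` {1..n}) + k"
    using assms(1) by (subst mono_Min_commute[symmetric]) (auto simp: mono_def)
  finally have "{j \<in> {1..n}. D j + k * L n j - Min ((\<lambda>i. D i + k * L n i) ` {1..n}) \<le> int i - 1}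
      = {j \<in> {1..n}. D j - Min (D ` {1..n}) \<le> int i - 1}" for i
    by (auto simp: L_def)
  then show ?thesis using assms(2) by (simp add: concentrated_def)
qed

theorem theorem1p3:
  fixes n :: nat and D e :: "nat \<Rightarrow> int"
  assumes "n \<ge> 1"
    and "divisor n D"
    and "super_sorted n D"
    and "concentrated n D"
    and "\<And>i. i \<in> {1..n} \<Longrightarrow> e i = D i - int i + 1"
  shows "has_splitting_type n D e"
  unfolding has_splitting_type_def
proof
  fix k :: int
  have "divisor n (\<lambda>i. D i + k * L n i)" using assms(2) by (simp add: divisor_def L_def)
  then have "rk n (\<lambda>i. D i + k * L n i) = (\<Sum>i=1..n. max 0 (D i + k * L n i - int i + 2)) - 1"
    using assms by (intro rk_concentrated super_sorted_twist concentrated_twist)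
  also have "(\<Sum>i=1..n. max 0 (D i + k * L n i - int i + 2)) = (\<Sum>i=1..n. max 0 (e i + k + 1))"
    by (intro sum.cong) (auto simp: L_def assms(5))
  finally show "rk n (\<lambda>i. D i + k * L n i) = (\<Sum>i = 1..n. max 0 (e i + k + 1)) - 1" .
qed

end
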